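(* For all $a,b>0$ with $a\ne b$, $$A^{2/3}G^{1/3}<\sqrt{\tfrac23AG+\tfrac13A^2}<\sqrt{AX}<A^{1/3}\left(\tfrac{A+G}{2}\right)^{2/3}<P<\frac{2\sqrt2\sqrt{A^2+AG}+A+G}{6}$$ $$<\left(\tfrac{\sqrt2}{3}\sqrt{A+G}+\tfrac13\sqrt A\right)^2<J<A^{-1/3}\left(\frac{\sqrt{2A}+\sqrt{A+G}}{2\sqrt2}\right)^{8/3}<\tfrac23A+\tfrac13G.$$
   Context: For $a,b>0$ with $a\neq b$: $A=\frac{a+b}{2}$, $G=\sqrt{ab}$, $P=\frac{a-b}{2\arcsin\frac{a-b}{a+b}}$ (first Seiffert mean), $X=A e^{G/P-1}$, and $J=A e^{(A+G)/P-2}$. *)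

theory Defs
  imports "HOL-Analysis.Analysis"
begin

definition arith_mean :: "real \<Rightarrow> real \<Rightarrow> real" where
  "arith_mean a b = (a + b) / 2"

definition geom_mean :: "real \<Rightarrow> real \<Rightarrow> real" where
  "geom_mean a b = sqrt (a * b)"

(* The first Seiffert mean. The formula is meaningful only for positive a and b with a \<noteq> b;
   on the diagonal it takes the junk value 0. *)
definition seiffert_mean :: "real \<Rightarrow> real \<Rightarrow> real" where
  "seiffert_mean a b = (a - b) / (2 * arcsin ((a - b) / (a + b)))"

definition X_mean :: "real \<Rightarrow> real \<Rightarrow> real" where
  "X_mean a b = arith_mean a b * exp (geom_mean a b / seiffert_mean a b - 1)"

definition J_mean :: "real \<Rightarrow> real \<Rightarrow> real" where
  "J_mean a b =
     arith_mean a b * exp ((arith_mean a b + geom_mean a b) / seiffert_mean a b - 2)"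

end

theory Submission
  imports Defs "HOL-Real_Asymp.Real_Asymp"
begin

text \<open>
  Put \<open>x = arcsin (\<bar>a - b\<bar> / (a + b))\<close>, so that \<open>G = A cos x\<close> and \<open>P = A sin x / x\<close>. Every member of
  the chain becomes \<open>A\<close> times a function of \<open>x\<close> in \<open>(0, pi/2)\<close>. By the half-angle formulas the
  bounds for \<open>P\<close> are the Mitrinovic--Adamovic and Cusa inequalities at \<open>x/2\<close>, and, because
  \<open>J = A exp (2 (y cot y - 1))\<close> with \<open>y = x/2\<close>, the bounds for \<open>J\<close> are those for \<open>X\<close> taken at \<open>x/2\<close>.
  Each trigonometric inequality reduces to a derivative whose numerator
  carries the factor \<open>(1 - cos x)\<^sup>2\<close>.
\<close>

text \<open>A limit replaces the value at 0 because later functions involve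
  \<open>x * cos x / sin x\<close>, which evaluates to 0 at 0 although it tends to 1.\<close>

lemma pos_if_deriv_pos:
  fixes f f' :: "real \<Rightarrow> real"
  assumes lim: "(f \<longlongrightarrow> 0) (at_right 0)" and "0 < b"
    and der: "\<And>x. 0 < x \<Longrightarrow> x \<le> b \<Longrightarrow> (f has_real_derivative f' x) (at x)"
    and pos: "\<And>x. 0 < x \<Longrightarrow> x \<le> b \<Longrightarrow> f' x > 0"
  shows "f b > 0"
proof -
  have mono: "f x < f y" if "0 < x" "x < y" "y \<le> b" for x y
  proof (rule DERIV_pos_imp_increasing[OF that(2)])
    fix t assume "x \<le> t" "t \<le> y"
    then have "0 < t" "t \<le> b" using that by auto
    then show "\<exists>D. DERIV f t :> D \<and> D > 0" using der pos by blast
  qed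
  \<comment> \<open>The limit preserves only weak inequalities; stopping at \<open>b/2\<close>
    leaves a further interval on which strict growth restores strictness.\<close>
  have "eventually (\<lambda>x. x \<in> {0<..<b/2}) (at_right 0)"
    using \<open>0 < b\<close> by (intro eventually_at_right_real) auto
  then have "eventually (\<lambda>x. f x \<le> f (b/2)) (at_right 0)"
    by eventually_elim (use \<open>0 < b\<close> mono[of _ "b/2"] in \<open>auto intro: less_imp_le\<close>)
  then have "0 \<le> f (b/2)"
    by (intro tendsto_upperbound[OF lim]) auto
  also have "\<dots> < f b"
    using mono[of "b/2" b] \<open>0 < b\<close> by simp
  finally show ?thesis .
qed

section \<open>Trigonometric bounds for x and sin x / x\<close>

lemma quarter_turn:
  fixes x :: real
  assumes "0 < x" "x < pi/2"
  shows "0 < sin x" "0 < cos x" "cos x < 1"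
proof -
  show "0 < sin x" using assms by (intro sin_gt_zero) auto
  show "0 < cos x" using assms by (intro cos_gt_zero_pi) auto
  show "cos x < 1" using cos_monotone_0_pi[of 0 x] assms by simp
qed

text \<open>Solving for x gives \<open>3 * sin x / (2 + cos x) < x\<close>, and the derivative of
  the difference is a perfect square.\<close>

lemma Cusa:
  fixes x :: real
  assumes "0 < x" "x < pi/2"
  shows "sin x / x < (2 + cos x) / 3"
proof -
  have "0 < x - 3 * sin x / (2 + cos x)"
  proof (rule pos_if_deriv_pos[where f = "\<lambda>x. x - 3 * sin x / (2 + cos x)"
        and f' = "\<lambda>x. (1 - cos x)\<^sup>2 / (2 + cos x)\<^sup>2"])
    show "((\<lambda>x::real. x - 3 * sin x / (2 + cos x)) \<longlongrightarrow> 0) (at_right 0)"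
      by (rule tendsto_eq_intros refl | simp)+
    fix t :: real assume t: "0 < t" "t \<le> x"
    note q = quarter_turn[of t]
    have c: "0 < cos t" "cos t < 1" using q t assms by auto
    show "((\<lambda>x. x - 3 * sin x / (2 + cos x)) has_real_derivative
        (1 - cos t)\<^sup>2 / (2 + cos t)\<^sup>2) (at t)"
      apply (rule derivative_eq_intros refl | (use c in \<open>simp; fail\<close>))+
      apply (use c in \<open>simp add: divide_simps\<close>)
      using sin_cos_squared_add[of t] by algebra
    show "0 < (1 - cos t)\<^sup>2 / (2 + cos t)\<^sup>2" using c by simp
  qed (use assms in auto)
  then show ?thesis
    using assms quarter_turn[of x] by (simp add: field_simps)
qed

text \<open>The gap between the two sides is the numerator of the derivative in
  \<open>x_cot_bound_lower\<close>; the bound also yields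
  \<open>Mitrinovic_Adamovic\<close>.\<close>

lemma less_sin_times_ratio:
  fixes x :: real
  assumes "0 < x" "x < pi/2"
  shows "x < sin x * (2 + cos x) / (1 + 2 * cos x)"
proof -
  have "0 < sin x * (2 + cos x) / (1 + 2 * cos x) - x"
  proof (rule pos_if_deriv_pos[where f = "\<lambda>x. sin x * (2 + cos x) / (1 + 2 * cos x) - x"
        and f' = "\<lambda>x. 2 * (1 - cos x)\<^sup>2 * (1 + cos x) / (1 + 2 * cos x)\<^sup>2"])
    show "((\<lambda>x::real. sin x * (2 + cos x) / (1 + 2 * cos x) - x) \<longlongrightarrow> 0) (at_right 0)"
      by (rule tendsto_eq_intros refl | simp)+
    fix t :: real assume t: "0 < t" "t \<le> x"
    note q = quarter_turn[of t]
    have c: "0 < cos t" "cos t < 1" using q t assms by auto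
    show "((\<lambda>x. sin x * (2 + cos x) / (1 + 2 * cos x) - x) has_real_derivative
        2 * (1 - cos t)\<^sup>2 * (1 + cos t) / (1 + 2 * cos t)\<^sup>2) (at t)"
      apply (rule derivative_eq_intros refl | (use c in \<open>simp; fail\<close>))+
      apply (use c in \<open>simp add: divide_simps\<close>)
      using sin_cos_squared_add[of t] by algebra
    show "0 < 2 * (1 - cos t)\<^sup>2 * (1 + cos t) / (1 + 2 * cos t)\<^sup>2" using c by simp
  qed (use assms in auto)
  then show ?thesis by simp
qed

text \<open>Supplies the sign of the derivative in \<open>x_cot_bound_upper\<close>.\<close>

lemma greater_sin_times_linear:
  fixes x :: real
  assumes "0 < x" "x < pi/2"
  shows "sin x * (4 - cos x) / 3 < x"
proof -
  have "0 < x - sin x * (4 - cos x) / 3"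
  proof (rule pos_if_deriv_pos[where f = "\<lambda>x. x - sin x * (4 - cos x) / 3"
        and f' = "\<lambda>x. 2 * (1 - cos x)\<^sup>2 / 3"])
    show "((\<lambda>x::real. x - sin x * (4 - cos x) / 3) \<longlongrightarrow> 0) (at_right 0)"
      by (rule tendsto_eq_intros refl | simp)+
    fix t :: real assume t: "0 < t" "t \<le> x"
    show "((\<lambda>x. x - sin x * (4 - cos x) / 3) has_real_derivative
        2 * (1 - cos t)\<^sup>2 / 3) (at t)"
      apply (rule derivative_eq_intros refl | (simp; fail))+
      apply (simp add: divide_simps)
      using sin_cos_squared_add[of t] by algebra
    show "0 < 2 * (1 - cos t)\<^sup>2 / 3" using quarter_turn[of t] t assms by simp
  qed (use assms in auto)
  then show ?thesis by simp
qed

text \<open>Turns inequalities with cube roots into polynomial ones in \<open>t\<close>.\<close>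

lemma cube_root_exists:
  fixes c :: real
  assumes "0 < c" "c < 1"
  obtains t where "t = c powr (1/3)" "0 < t" "t < 1" "c = t^3"
proof
  show "0 < c powr (1/3)" "c = (c powr (1/3))^3"
    using assms by (simp_all add: powr_power)
  show "c powr (1/3) < 1"
    using assms powr_less_mono2[of "1/3" c 1] by simp
qed simp

text \<open>With \<open>t = cos x powr (1/3)\<close>, this follows from \<open>t * (2 + t^3) < 1 + 2 * t^3\<close>, that is,
  from \<open>(1 - t)^3 * (1 + t) > 0\<close>.\<close>
lemma Mitrinovic_Adamovic:
  fixes x :: real
  assumes "0 < x" "x < pi/2"
  shows "cos x powr (1/3) < sin x / x"
proof -
  note q = quarter_turn[OF assms]
  obtain t where t: "t = cos x powr (1/3)" "0 < t" "t < 1" "cos x = t^3"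
    using cube_root_exists q by metis
  have "0 < (1 - t)^3 * (1 + t)" using t(2,3) by simp
  also have "\<dots> = 1 + 2 * t^3 - t * (2 + t^3)"
    by algebra
  finally have *: "t * (2 + cos x) < 1 + 2 * cos x" using t(4) by simp
  have "t * x < t * (sin x * (2 + cos x) / (1 + 2 * cos x))"
    using less_sin_times_ratio[OF assms] t(2) by (rule mult_strict_left_mono)
  also have "\<dots> = sin x * (t * (2 + cos x) / (1 + 2 * cos x))" by simp
  also have "\<dots> < sin x * 1"
    using * q by (intro mult_strict_left_mono) (auto simp: divide_simps)
  finally show ?thesis
    using assms by (simp add: field_simps flip: t(1))
qed

section \<open>Bounds for exp (x cot x - 1)\<close>

text \<open>After taking logarithms both sides tend to 0 at 0, and the derivative of their
  difference times sin^2 x is exactly the gap in \<open>less_sin_times_ratio\<close>.\<close>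

lemma x_cot_bound_lower:
  fixes x :: real
  assumes "0 < x" "x < pi/2"
  shows "(2 * cos x + 1) / 3 < exp (x * cos x / sin x - 1)"
proof -
  have "0 < x * cos x / sin x - 1 - ln ((2 * cos x + 1) / 3)"
  proof (rule pos_if_deriv_pos[where f = "\<lambda>x. x * cos x / sin x - 1 - ln ((2 * cos x + 1) / 3)"
        and f' = "\<lambda>x. (sin x * (2 + cos x) / (1 + 2 * cos x) - x) / (sin x)\<^sup>2"])
    show "((\<lambda>x::real. x * cos x / sin x - 1 - ln ((2 * cos x + 1) / 3)) \<longlongrightarrow> 0) (at_right 0)"
      by real_asymp
    fix t :: real assume t: "0 < t" "t \<le> x"
    note q = quarter_turn[of t]
    have c: "0 < sin t" "0 < cos t" "cos t < 1" using q t assms by auto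
    show "((\<lambda>x. x * cos x / sin x - 1 - ln ((2 * cos x + 1) / 3)) has_real_derivative
        (sin t * (2 + cos t) / (1 + 2 * cos t) - t) / (sin t)\<^sup>2) (at t)"
      apply (rule derivative_eq_intros refl | (use c in \<open>simp; fail\<close>))+
      apply (use c in \<open>simp add: divide_simps\<close>)
      using sin_cos_squared_add[of t] by algebra
    show "0 < (sin t * (2 + cos t) / (1 + 2 * cos t) - t) / (sin t)\<^sup>2"
      using c less_sin_times_ratio[of t] t assms by simp
  qed (use assms in auto)
  then show ?thesis
    using quarter_turn[OF assms] by (simp flip: exp_less_cancel_iff[of "ln _"])
qed

text \<open>The exponent 4/3 matches leading terms: x cot x - 1 and (4/3) ln ((1 + cos x) / 2) both
  begin with -x^2/3. The sign of the derivative of their difference comes from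
  \<open>greater_sin_times_linear\<close>.\<close>

lemma x_cot_bound_upper:
  fixes x :: real
  assumes "0 < x" "x < pi/2"
  shows "exp (x * cos x / sin x - 1) < ((1 + cos x) / 2) powr (4/3)"
proof -
  have "0 < 4/3 * ln ((1 + cos x) / 2) - x * cos x / sin x + 1"
  proof (rule pos_if_deriv_pos[where f = "\<lambda>x. 4/3 * ln ((1 + cos x) / 2) - x * cos x / sin x + 1"
        and f' = "\<lambda>x. (x - sin x * (4 - cos x) / 3) / (sin x)\<^sup>2"])
    show "((\<lambda>x::real. 4/3 * ln ((1 + cos x) / 2) - x * cos x / sin x + 1) \<longlongrightarrow> 0) (at_right 0)"
      by real_asymp
    fix t :: real assume t: "0 < t" "t \<le> x"
    note q = quarter_turn[of t]
    have c: "0 < sin t" "0 < cos t" "cos t < 1" using q t assms by auto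
    show "((\<lambda>x. 4/3 * ln ((1 + cos x) / 2) - x * cos x / sin x + 1) has_real_derivative
        (t - sin t * (4 - cos t) / 3) / (sin t)\<^sup>2) (at t)"
      apply (rule derivative_eq_intros refl | (use c in \<open>simp; fail\<close>))+
      apply (use c in \<open>simp add: divide_simps\<close>)
      using sin_cos_squared_add[of t] by algebra
    show "0 < (t - sin t * (4 - cos t) / 3) / (sin t)\<^sup>2"
      using c greater_sin_times_linear[of t] t assms by simp
  qed (use assms in auto)
  then show ?thesis
    using quarter_turn[OF assms] by (simp add: powr_def)
qed

section \<open>Algebraic comparisons for the two ends of the chain\<close>

text \<open>With c = t^3, squaring leaves 2 t^3 - 3 t^2 + 1 > 0, a cubic with a double root at t =
  1.\<close>

lemma cube_root_less_sqrt:
  fixes c :: real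
  assumes "0 < c" "c < 1"
  shows "c powr (1/3) < sqrt ((2 * c + 1) / 3)"
proof -
  obtain t where t: "t = c powr (1/3)" "0 < t" "t < 1" "c = t^3"
    using cube_root_exists assms by metis
  have "0 < (1 - t)\<^sup>2 * (2 * t + 1)" using t(2,3) by simp
  also have "\<dots> = 2 * t^3 + 1 - 3 * t\<^sup>2" by algebra
  finally have "t\<^sup>2 < (2 * c + 1) / 3" using t(4) by simp
  then show ?thesis unfolding t(1) by (rule real_less_rsqrt)
qed

text \<open>The logarithm of the ratio of right to left side vanishes at 1 and strictly decreases on
  the way there. It is continuous at 1, so its value there can be used directly.\<close>

lemma mean_powr_less:
  fixes u :: real
  assumes "0 < u" "u < 1"
  shows "((1 + u) / 2) powr (8/3) < (1 + 2 * u\<^sup>2) / 3"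
proof -
  define f where "f = (\<lambda>u::real. ln ((1 + 2 * u\<^sup>2) / 3) - 8/3 * ln ((1 + u) / 2))"
  have p: "0 < 1 + 2 * t\<^sup>2" for t :: real
    by (simp add: add_pos_nonneg)
  have "f u > f 1"
  proof (rule DERIV_neg_imp_decreasing_open[OF assms(2)])
    fix t assume t: "u < t" "t < 1"
    have d: "(f has_real_derivative 4 * t / (1 + 2 * t\<^sup>2) - 8 / (3 * (1 + t))) (at t)"
      unfolding f_def using t assms p[of t]
      by (auto intro!: derivative_eq_intros simp: divide_simps) algebra
    have "4 * t / (1 + 2 * t\<^sup>2) - 8 / (3 * (1 + t))
        = - (4 * (1 - t) * (2 - t)) / ((1 + 2 * t\<^sup>2) * (3 * (1 + t)))"
      using t assms p[of t] by (subst diff_frac_eq) (auto simp: power2_eq_square algebra_simps)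
    also have "\<dots> < 0"
      using t assms p[of t] by (intro divide_neg_pos) (auto intro!: mult_pos_pos)
    finally show "\<exists>y. DERIV f t :> y \<and> y < 0" using d by blast
  next
    show "continuous_on {u..1} f"
      unfolding f_def using assms p by (auto intro!: continuous_intros simp: less_imp_neq[symmetric])
  qed
  then show ?thesis
    using assms p[of u] by (simp add: f_def powr_def flip: exp_less_cancel_iff[of _ "ln _"])
qed

theorem proposition4:
  fixes a b :: real
  assumes "a > 0" and "b > 0" and "a \<noteq> b"
  shows "let A = arith_mean a b; G = geom_mean a b; P = seiffert_mean a b;
             X = X_mean a b; J = J_mean a b
         in A powr (2/3) * G powr (1/3) < sqrt (2/3 * A * G + 1/3 * A\<^sup>2)
          \<and> sqrt (2/3 * A * G + 1/3 * A\<^sup>2) < sqrt (A * X)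
          \<and> sqrt (A * X) < A powr (1/3) * ((A + G) / 2) powr (2/3)
          \<and> A powr (1/3) * ((A + G) / 2) powr (2/3) < P
          \<and> P < (2 * sqrt 2 * sqrt (A\<^sup>2 + A * G) + A + G) / 6
          \<and> (2 * sqrt 2 * sqrt (A\<^sup>2 + A * G) + A + G) / 6
              < (sqrt 2 / 3 * sqrt (A + G) + 1/3 * sqrt A)\<^sup>2
          \<and> (sqrt 2 / 3 * sqrt (A + G) + 1/3 * sqrt A)\<^sup>2 < J
          \<and> J < A powr (-1/3) * ((sqrt (2 * A) + sqrt (A + G)) / (2 * sqrt 2)) powr (8/3)
          \<and> A powr (-1/3) * ((sqrt (2 * A) + sqrt (A + G)) / (2 * sqrt 2)) powr (8/3)
              < 2/3 * A + 1/3 * G"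
proof -

  \<comment> \<open>Means in terms of the angle x and its half y\<close>
  define A where "A = (a + b) / 2"
  \<comment> \<open>The absolute value makes \<open>x\<close> positive for either order of
    \<open>a\<close> and \<open>b\<close>.\<close>
  define s where "s = \<bar>a - b\<bar> / (a + b)"
  define x where "x = arcsin s"
  define c where "c = cos x"
  define y where "y = x / 2"
  define u where "u = cos y"
  have A: "A > 0" using assms by (simp add: A_def)
  have s: "0 < s" "s < 1" using assms by (auto simp: s_def)
  have sin_x: "sin x = s" using s by (simp add: x_def)
  have x: "0 < x" "x < pi/2"
    using s arcsin_less_mono[of 0 s] arcsin_less_mono[of s 1] by (auto simp: x_def)
  then have y: "0 < y" "y < pi/2" by (auto simp: y_def)
  have c: "0 < c" "c < 1" using quarter_turn[OF x] by (auto simp: c_def)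
  have u: "0 < u" "u < 1" using quarter_turn[OF y] by (auto simp: u_def)
  have sy: "0 < sin y" using quarter_turn[OF y] by simp
  have cu: "1 + c = 2 * u\<^sup>2"
    using cos_double_cos[of y] by (simp add: c_def u_def y_def)
  have ssu: "s = 2 * sin y * u"
    using sin_double[of y] sin_x by (simp add: u_def y_def)
  have As: "A * s = \<bar>a - b\<bar> / 2"
    using assms by (simp add: A_def s_def divide_simps)
  have AG: "geom_mean a b = A * c"
  proof -
    have "(A * s)\<^sup>2 = ((a - b) / 2)\<^sup>2" by (simp only: As power_divide power2_abs)
    moreover have "(A * c)\<^sup>2 = A\<^sup>2 - (A * s)\<^sup>2"
      using sin_cos_squared_add[of x] sin_x by (simp add: c_def power_mult_distrib cos_squared_eq algebra_simps)
    ultimately have "(A * c)\<^sup>2 = a * b"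
      by (simp add: A_def power2_eq_square field_simps)
    then show ?thesis
      unfolding geom_mean_def using A c by (metis less_imp_le mult_pos_pos real_sqrt_unique)
  qed
  \<comment> \<open>Numerator and arcsine are both odd in a - b, so the two signs cancel when a <
    b.\<close>
  have AP: "seiffert_mean a b = A * (s / x)"
  proof (cases "a > b")
    case True
    then have "(a - b) / (a + b) = s" by (simp add: s_def)
    moreover have "a - b = 2 * (A * s)" unfolding As using True by simp
    ultimately show ?thesis by (simp add: seiffert_mean_def x_def)
  next
    case False
    then have "(a - b) / (a + b) = - s"
      by (simp add: s_def minus_divide_left del: divide_minus_left)
    moreover have "a - b = - (2 * (A * s))" unfolding As using False by (simp add: abs_if field_simps)
    ultimately show ?thesis using s by (simp add: seiffert_mean_def x_def arcsin_minus)
  qed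
  have "A * c / (A * (s / x)) = x * cos x / sin x"
    using A by (simp add: sin_x c_def)
  then have AX: "X_mean a b = A * exp (x * cos x / sin x - 1)"
    unfolding X_mean_def AG AP by (simp add: arith_mean_def A_def)
  \<comment> \<open>By 1 + cos x = 2 cos^2 y and sin x = 2 sin y cos y, this quotient is 2 y cot y;
    hence J / A is the square of the exponential factor of X taken at y.\<close>
  have "(A + A * c) / (A * (s / x)) = A * (1 + c) / (A * (s / x))"
    by (simp only: distrib_left mult_1_right)
  also have "\<dots> = (1 + c) * x / s"
    using A by simp
  also have "\<dots> = 2 * (y * cos y / sin y)"
    unfolding cu ssu using u sy by (simp add: y_def power2_eq_square flip: u_def[unfolded y_def])
  finally have AJ: "J_mean a b = A * (exp (y * cos y / sin y - 1))\<^sup>2"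
    unfolding J_mean_def AG AP by (simp add: arith_mean_def A_def flip: exp_double)

  \<comment> \<open>Factoring A out of each member of the chain\<close>
  have e1: "A powr (2/3) * (A * c) powr (1/3) = A * c powr (1/3)"
    using A c by (simp add: powr_mult flip: mult.assoc powr_add)
  have e2: "sqrt (2/3 * A * (A * c) + 1/3 * A\<^sup>2) = A * sqrt ((2 * c + 1) / 3)"
  proof -
    have "2/3 * A * (A * c) + 1/3 * A\<^sup>2 = A\<^sup>2 * ((2 * c + 1) / 3)"
      by (simp add: field_simps power2_eq_square)
    then show ?thesis using A by (simp only: real_sqrt_mult) simp
  qed
  have e3: "sqrt (A * X_mean a b) = A * sqrt (exp (x * cos x / sin x - 1))"
    unfolding AX using A by (simp add: real_sqrt_mult flip: mult.assoc)
  have e4: "A powr (1/3) * ((A + A * c) / 2) powr (2/3) = A * ((1 + c) / 2) powr (2/3)"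
  proof -
    have "(A + A * c) / 2 = A * ((1 + c) / 2)" by (simp add: field_simps)
    then show ?thesis using A c by (simp only: powr_mult) (simp flip: mult.assoc powr_add)
  qed
  have e5: "sqrt (A\<^sup>2 + A * (A * c)) = A * (sqrt 2 * u)"
  proof -
    have "A\<^sup>2 + A * (A * c) = A\<^sup>2 * (2 * u\<^sup>2)"
      unfolding cu[symmetric] by (simp add: power2_eq_square algebra_simps)
    then show ?thesis using A u by (simp add: real_sqrt_mult)
  qed
  have e6: "sqrt (A + A * c) = sqrt A * (sqrt 2 * u)"
  proof -
    have "A + A * c = A * (2 * u\<^sup>2)"
      unfolding cu[symmetric] by (simp add: algebra_simps)
    then show ?thesis using u by (simp add: real_sqrt_mult)
  qed
  have e5': "(2 * sqrt 2 * sqrt (A\<^sup>2 + A * (A * c)) + A + A * c) / 6 = A * ((2 * u + u\<^sup>2) / 3)"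
  proof -
    have "A + A * c = A * (2 * u\<^sup>2)"
      unfolding cu[symmetric] by (simp add: algebra_simps)
    then show ?thesis unfolding e5 add.assoc by (simp add: field_simps)
  qed
  have e6': "(sqrt 2 / 3 * sqrt (A + A * c) + 1/3 * sqrt A)\<^sup>2 = A * ((2 * u + 1) / 3)\<^sup>2"
  proof -
    have "sqrt 2 / 3 * sqrt (A + A * c) + 1/3 * sqrt A = sqrt A * ((2 * u + 1) / 3)"
      unfolding e6 by (simp add: field_simps)
    then show ?thesis using A by (simp only: power_mult_distrib) simp
  qed
  \<comment> \<open>The base contributes \<open>A powr (1/2)\<close>, and -1/3 + (1/2)(8/3) =
    1.\<close>
  have e8: "A powr (-1/3) * ((sqrt (2 * A) + sqrt (A + A * c)) / (2 * sqrt 2)) powr (8/3)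
      = A * ((1 + u) / 2) powr (8/3)"
  proof -
    have "(sqrt (2 * A) + sqrt (A + A * c)) / (2 * sqrt 2) = A powr (1/2) * ((1 + u) / 2)"
      unfolding e6 using A by (simp add: real_sqrt_mult powr_half_sqrt field_simps)
    then show ?thesis
      using A u by (simp only: powr_mult powr_powr) (simp flip: mult.assoc powr_add)
  qed
  have e9: "2/3 * A + 1/3 * (A * c) = A * ((1 + 2 * u\<^sup>2) / 3)"
    unfolding cu[symmetric] by (simp add: field_simps)
  have m: "A * p < A * q" if "p < q" for p q
    using A that by simp

  \<comment> \<open>The nine inequalities after division by A\<close>
  have 1: "c powr (1/3) < sqrt ((2 * c + 1) / 3)"
    using cube_root_less_sqrt c by blast
  have 2: "sqrt ((2 * c + 1) / 3) < sqrt (exp (x * cos x / sin x - 1))"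
    using x_cot_bound_lower[OF x] by (simp add: c_def)
  have 3: "sqrt (exp (x * cos x / sin x - 1)) < ((1 + c) / 2) powr (2/3)"
  proof -
    have "sqrt (exp (x * cos x / sin x - 1)) < sqrt (((1 + c) / 2) powr (4/3))"
      using x_cot_bound_upper[OF x] by (simp add: c_def)
    also have "\<dots> = ((1 + c) / 2) powr (2/3)"
      using c by (subst powr_half_sqrt[symmetric]) (simp_all add: powr_powr)
    finally show ?thesis .
  qed
  have half: "s / x = u * (sin y / y)"
    unfolding ssu y_def by simp
  have 4: "((1 + c) / 2) powr (2/3) < s / x"
  proof -
    \<comment> \<open>As (1 + c) / 2 = u^2, the left side is u^(4/3); splitting off one factor u
      matches \<open>half\<close>.\<close>
    have "((1 + c) / 2) powr (2/3) = u * u powr (1/3)"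
      using u by (simp add: cu powr_powr powr_mult_base flip: powr_numeral)
    also have "\<dots> < u * (sin y / y)"
      using Mitrinovic_Adamovic[OF y] u by (intro mult_strict_left_mono) (auto simp: u_def)
    finally show ?thesis unfolding half .
  qed
  have 5: "s / x < (2 * u + u\<^sup>2) / 3"
  proof -
    have "s / x < u * ((2 + u) / 3)"
      unfolding half using Cusa[OF y] u by (intro mult_strict_left_mono) (auto simp: u_def)
    then show ?thesis by (simp add: power2_eq_square algebra_simps)
  qed
  have 6: "(2 * u + u\<^sup>2) / 3 < ((2 * u + 1) / 3)\<^sup>2"
  proof -
    \<comment> \<open>The right side minus the left side equals (1 - u)^2 / 9.\<close>
    have "0 < (1 - u)\<^sup>2" using u by simp
    then show ?thesis by (simp add: power2_eq_square field_simps)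
  qed
  have 7: "((2 * u + 1) / 3)\<^sup>2 < (exp (y * cos y / sin y - 1))\<^sup>2"
    using x_cot_bound_lower[OF y] u by (intro power_strict_mono) (auto simp: u_def)
  have 8: "(exp (y * cos y / sin y - 1))\<^sup>2 < ((1 + u) / 2) powr (8/3)"
  proof -
    have "(exp (y * cos y / sin y - 1))\<^sup>2 < (((1 + u) / 2) powr (4/3))\<^sup>2"
      using x_cot_bound_upper[OF y] by (intro power_strict_mono) (auto simp: u_def)
    also have "\<dots> = ((1 + u) / 2) powr (8/3)"
      using u by (simp add: powr_power)
    finally show ?thesis .
  qed
  have 9: "((1 + u) / 2) powr (8/3) < (1 + 2 * u\<^sup>2) / 3"
    using mean_powr_less u by blast
  have "arith_mean a b = A" by (simp add: arith_mean_def A_def)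
  then show ?thesis
    unfolding Let_def AG AP AJ
    \<comment> \<open>Once every member has the form A times a scalar, \<open>m\<close> lifts the
      nine scalar inequalities to the means.\<close>
    using 1 2 3 4 5 6 7 8 9 by (simp only: e1 e2 e3 e4 e5' e6' e8 e9 m simp_thms)
qed

end
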